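(* Let $(\mathbf{v}_t)_{t\in\mathbb{N}}$ be a sequence of integrable random vectors in $\mathbb{R}^d$ such that $\mathbb{E}[\mathbf{v}_t\mid\mathcal{F}_{t-1}]=\mathbf{0}$ for all $t\in\mathbb{N}$, where $\mathcal{F}_t:=\sigma(\mathbf{v}_1,\dots,\mathbf{v}_t)$ is the natural filtration. Then for any $\mathfrak{p}\in[1,2]$, $$\mathbb{E}\left[\left\|\sum_{t=1}^T\mathbf{v}_t\right\|\right]\le2\sqrt2\,\mathbb{E}\left[\left(\sum_{t=1}^T\|\mathbf{v}_t\|^{\mathfrak{p}}\right)^{\frac1{\mathfrak{p}}}\right],\qquad\forall T\in\mathbb{N}.$$
   Context: $\mathbb{N}=\{1,2,\dots\}$, $\|\cdot\|$ is the Euclidean norm on $\mathbb{R}^d$, and $\mathcal{F}_0$ is the trivial $\sigma$-algebra. *)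

theory Defs
  imports "HOL-Probability.Probability"
begin

text \<open>
  The sequence is indexed from 1, so \<open>v 0\<close> plays no role, and at \<open>t = 0\<close> the generating
  family is empty and the \<open>\<sigma>\<close>-algebra is trivial.
\<close>
definition natural_filtration ::
    "'a measure \<Rightarrow> (nat \<Rightarrow> 'a \<Rightarrow> 'b::topological_space) \<Rightarrow> nat \<Rightarrow> 'a measure" where
  "natural_filtration M v t =
     sigma (space M) (\<Union>s\<in>{1..t}. {v s -` A \<inter> space M | A. A \<in> sets borel})"

text \<open>
  The library's conditional expectation is real-valued; that of a random vector is taken
  coordinatewise. As for \<^const>\<open>real_cond_exp\<close>, this picks one version, so
  equations about it are to be stated almost everywhere.
\<close>
definition vec_cond_exp ::
    "'a measure \<Rightarrow> 'a measure \<Rightarrow> ('a \<Rightarrow> real ^ 'd) \<Rightarrow> 'a \<Rightarrow> real ^ 'd" where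
  "vec_cond_exp M F f = (\<lambda>\<omega>. \<chi> i. real_cond_exp M F (\<lambda>\<omega>'. f \<omega>' $ i) \<omega>)"

lemma space_natural_filtration [simp]: "space (natural_filtration M v t) = space M"
  unfolding natural_filtration_def by (rule space_measure_of) auto

lemma sets_natural_filtration:
  "sets (natural_filtration M v t) =
     sigma_sets (space M) (\<Union>s\<in>{1..t}. {v s -` A \<inter> space M | A. A \<in> sets borel})"
  unfolding natural_filtration_def by (rule sets_measure_of) auto

lemma sets_natural_filtration_0: "sets (natural_filtration M v 0) = {{}, space M}"
  unfolding sets_natural_filtration by (simp add: sigma_sets_empty_eq)

lemma subalgebra_natural_filtration:
  assumes "\<And>s. 1 \<le> s \<Longrightarrow> s \<le> t \<Longrightarrow> v s \<in> borel_measurable M"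
  shows "subalgebra M (natural_filtration M v t)"
  unfolding subalgebra_def sets_natural_filtration
  using assms by (auto intro!: sets.sigma_sets_subset measurable_sets)

lemma measurable_natural_filtration:
  assumes "1 \<le> s" "s \<le> t"
  shows "v s \<in> borel_measurable (natural_filtration M v t)"
proof (rule measurableI)
  fix A :: "'b set" assume "A \<in> sets borel"
  then show "v s -` A \<inter> space (natural_filtration M v t) \<in> sets (natural_filtration M v t)"
    unfolding sets_natural_filtration space_natural_filtration
    using assms by (intro sigma_sets.Basic UN_I[of s]) auto
qed simp

text \<open>The defining properties of a conditional expectation, for \<^const>\<open>vec_cond_exp\<close>.\<close>

lemma borel_measurable_vec_cond_exp:
  fixes f :: "'a \<Rightarrow> real ^ 'd"
  shows "vec_cond_exp M F f \<in> borel_measurable F"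
proof (subst borel_measurable_iff_halfspace_le, safe)
  fix a :: real and b :: "real ^ 'd" assume "b \<in> Basis"
  then obtain i where b: "b = axis i 1" by (auto simp: Basis_vec_def)
  have [measurable]: "real_cond_exp M F (\<lambda>\<omega>. f \<omega> $ i) \<in> borel_measurable F"
    by (rule borel_measurable_cond_exp)
  show "{w \<in> space F. vec_cond_exp M F f w \<bullet> b \<le> a} \<in> sets F"
    unfolding b vec_cond_exp_def by (simp add: inner_axis)
qed

lemma vec_integrable_iff:
  fixes f :: "'a \<Rightarrow> real ^ 'd"
  shows "integrable M f \<longleftrightarrow> (\<forall>i. integrable M (\<lambda>x. f x $ i))"
proof
  assume "integrable M f"
  then show "\<forall>i. integrable M (\<lambda>x. f x $ i)"
    using integrable_bounded_linear[OF bounded_linear_vec_nth] by blast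
next
  assume *: "\<forall>i. integrable M (\<lambda>x. f x $ i)"
  have "integrable M (\<lambda>x. \<Sum>i\<in>UNIV. f x $ i *\<^sub>R (axis i 1 :: real ^ 'd))"
    using * by (intro Bochner_Integration.integrable_sum integrable_scaleR_left) auto
  moreover have "(\<lambda>x. \<Sum>i\<in>UNIV. f x $ i *\<^sub>R axis i 1) = f"
    by (rule ext, simp add: vec_eq_iff axis_def if_distrib cong: if_cong)
  ultimately show "integrable M f" by simp
qed

lemma (in sigma_finite_subalgebra) integrable_vec_cond_exp:
  "integrable M f \<Longrightarrow> integrable M (vec_cond_exp M F f)"
  unfolding vec_integrable_iff by (simp add: vec_cond_exp_def real_cond_exp_int)

lemma (in sigma_finite_subalgebra) vec_cond_exp_intA:
  fixes f :: "'a \<Rightarrow> real ^ 'd"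
  assumes f: "integrable M f" and A: "A \<in> sets F"
  shows "(\<integral>x\<in>A. f x \<partial>M) = (\<integral>x\<in>A. vec_cond_exp M F f x \<partial>M)"
proof -
  have AM: "A \<in> sets M" using A subalg by (auto simp: subalgebra_def)
  have nth: "(\<integral>x\<in>A. g x \<partial>M) $ i = (\<integral>x\<in>A. g x $ i \<partial>M)" if "integrable M g"
    for g :: "'a \<Rightarrow> real ^ 'd" and i
    unfolding set_lebesgue_integral_def
    using integral_bounded_linear[OF bounded_linear_vec_nth integrable_mult_indicator[OF AM that]]
    by (metis (mono_tags, lifting) Bochner_Integration.integral_cong vector_scaleR_component)
  show ?thesis
  proof (rule vec_eq_iff[THEN iffD2], rule allI)
    fix i
    have "integrable M (\<lambda>x. f x $ i)" using f by (simp add: vec_integrable_iff)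
    then show "(\<integral>x\<in>A. f x \<partial>M) $ i = (\<integral>x\<in>A. vec_cond_exp M F f x \<partial>M) $ i"
      using real_cond_exp_intA[OF _ A]
      by (simp add: nth f integrable_vec_cond_exp) (simp add: vec_cond_exp_def)
  qed
qed

end

theory Submission
  imports Defs
begin

text \<open>
  The bound is an expected-regret bound. Adaptive projected gradient ascent on the unit ball plays
  predictable points \<open>x\<^sub>t\<close> with, for every \<open>u\<close> in the ball,
  \<open>\<Sum> v\<^sub>t \<bullet> (u - x\<^sub>t) \<le> 2 \<surd>2 (\<Sum> \<parallel>v\<^sub>t\<parallel>\<^sup>2)\<^sup>1\<^sup>/\<^sup>2\<close>, pathwise.
  For \<open>u\<close> the direction of \<open>\<Sum> v\<^sub>t\<close>, the first part of the left-hand side is the norm of the sum;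
  the part \<open>\<Sum> v\<^sub>t \<bullet> x\<^sub>t\<close> has expectation zero because \<open>x\<^sub>t\<close> is bounded and predictable. Finally the
  \<open>\<ell>\<^sup>2\<close> norm is at most the \<open>\<ell>\<^sup>p\<close> norm for \<open>p \<le> 2\<close>.
\<close>

section \<open>Pathwise regret of adaptive gradient ascent\<close>

text \<open>
  \<open>ascent_point v t\<close> depends on \<open>v 1, \<dots>, v t\<close> only; it is the point played in round \<open>t + 1\<close>.
  When all these vectors vanish, the step size \<open>\<surd>2 / 0 = 0\<close> is harmless.
\<close>
primrec ascent_point :: "(nat \<Rightarrow> 'b::euclidean_space) \<Rightarrow> nat \<Rightarrow> 'b" where
  "ascent_point v 0 = 0"
| "ascent_point v (Suc t) = closest_point (cball 0 1)
     (ascent_point v t + (sqrt 2 / sqrt (\<Sum>s=1..Suc t. (norm (v s))\<^sup>2)) *\<^sub>R v (Suc t))"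

lemma norm_ascent_point_le:
  fixes v :: "nat \<Rightarrow> 'b::euclidean_space"
  shows "norm (ascent_point v t) \<le> 1"
proof (cases t)
  case (Suc k)
  have "closest_point (cball 0 1) y \<in> cball 0 1" for y :: 'b
    by (rule closest_point_in_set) auto
  then show ?thesis
    using Suc by (metis ascent_point.simps(2) mem_cball_0)
qed simp

text \<open>Projection onto the ball is nonexpansive and fixes \<open>u\<close>, so projecting never
  moves the iterate away from \<open>u\<close>.\<close>

lemma dist_ascent_point_Suc_le:
  fixes v :: "nat \<Rightarrow> 'b::euclidean_space"
  assumes "norm u \<le> 1"
  shows "norm (ascent_point v (Suc t) - u) \<le>
    norm (ascent_point v t + (sqrt 2 / sqrt (\<Sum>s=1..Suc t. (norm (v s))\<^sup>2)) *\<^sub>R v (Suc t) - u)"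
proof -
  have "closest_point (cball 0 1) u = u"
    using assms by (intro closest_point_self) simp
  then show ?thesis
    using closest_point_lipschitz[of "cball 0 1"
        "ascent_point v t + (sqrt 2 / sqrt (\<Sum>s=1..Suc t. (norm (v s))\<^sup>2)) *\<^sub>R v (Suc t)" u]
    by (simp add: dist_norm)
qed

text \<open>The squared distance to \<open>u\<close>, divided by twice the current step size, serves
  as a potential. Keeping it on the left strengthens the regret bound enough for induction on
  \<open>T\<close>.\<close>

lemma ascent_regret_potential:
  fixes v :: "nat \<Rightarrow> 'b::euclidean_space"
  assumes u: "norm u \<le> 1"
  shows "(\<Sum>t=1..T. v t \<bullet> (u - ascent_point v (t - 1)))
      + (norm (ascent_point v T - u))\<^sup>2 * sqrt (\<Sum>t=1..T. (norm (v t))\<^sup>2) / (2 * sqrt 2)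
    \<le> 2 * sqrt 2 * sqrt (\<Sum>t=1..T. (norm (v t))\<^sup>2)"
proof (induction T)
  case (Suc T)
  define x where "x = ascent_point v T"
  define w where "w = v (Suc T)"
  define r where "r = sqrt (\<Sum>t=1..T. (norm (v t))\<^sup>2)"
  define s where "s = sqrt (\<Sum>t=1..Suc T. (norm (v t))\<^sup>2)"
  define d where "d = (norm (x - u))\<^sup>2"
  define e where "e = (norm (ascent_point v (Suc T) - u))\<^sup>2"
  have r: "r \<ge> 0" and s: "s \<ge> 0"
    unfolding r_def s_def by (rule real_sqrt_ge_zero, rule sum_nonneg, simp)+
  have "s\<^sup>2 = (\<Sum>t=1..Suc T. (norm (v t))\<^sup>2)" and "r\<^sup>2 = (\<Sum>t=1..T. (norm (v t))\<^sup>2)"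
    unfolding r_def s_def by (rule real_sqrt_pow2, rule sum_nonneg, simp)+
  then have s2: "s\<^sup>2 = r\<^sup>2 + (norm w)\<^sup>2"
    by (simp add: w_def)
  then have "r\<^sup>2 \<le> s\<^sup>2" by simp
  then have rs: "r \<le> s" using s by (rule power2_le_imp_le)
  have "norm (x - u) \<le> 2"
    using norm_triangle_ineq4[of x u] norm_ascent_point_le[of v T] u unfolding x_def by linarith
  then have d: "d \<le> 4" unfolding d_def using power_mono[of "norm (x - u)" 2 2] by simp
  \<comment> \<open>One round: the right-hand side carries the old potential and an increment of
    \<open>s\<close> over \<open>r\<close>, so it telescopes against the induction
    hypothesis.\<close>
  have step: "w \<bullet> (u - x) + e * s / (2 * sqrt 2)
      \<le> d * r / (2 * sqrt 2) + 2 * sqrt 2 * (s - r)"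
  proof (cases "s = 0")
    case True
    then have "w = 0" "r = 0" using s2 r rs by auto
    then show ?thesis using True by simp
  next
    case False
    with s have spos: "s > 0" by simp
    have "e \<le> (norm (x + (sqrt 2 / s) *\<^sub>R w - u))\<^sup>2"
      unfolding e_def x_def w_def s_def by (intro power_mono dist_ascent_point_Suc_le u) simp
    also have "\<dots> = (norm ((x - u) + (sqrt 2 / s) *\<^sub>R w))\<^sup>2"
      by (simp add: algebra_simps)
    also have "\<dots> = d - 2 * (sqrt 2 / s) * (w \<bullet> (u - x)) + (2 / s\<^sup>2) * (norm w)\<^sup>2"
      unfolding d_def power2_norm_eq_inner
      by (simp add: inner_commute algebra_simps diff_divide_distrib power2_eq_square)
    finally have e: "e \<le> d - 2 * (sqrt 2 / s) * (w \<bullet> (u - x)) + (2 / s\<^sup>2) * (norm w)\<^sup>2" .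
    have "e * s / (2 * sqrt 2)
        \<le> (d - 2 * (sqrt 2 / s) * (w \<bullet> (u - x)) + (2 / s\<^sup>2) * (norm w)\<^sup>2) * (s / (2 * sqrt 2))"
      using mult_right_mono[OF e, of "s / (2 * sqrt 2)"] s by simp
    also have "\<dots> = d * s / (2 * sqrt 2) - w \<bullet> (u - x) + (norm w)\<^sup>2 / (sqrt 2 * s)"
      using spos by (simp add: field_simps power2_eq_square)
    finally have 1: "w \<bullet> (u - x) + e * s / (2 * sqrt 2)
        \<le> d * s / (2 * sqrt 2) + (norm w)\<^sup>2 / (sqrt 2 * s)" by simp
    \<comment> \<open>The gradient error is made telescoping by factoring a difference of squares
      and using \<open>s + r\<close> \<le> \<open>2 * s\<close>.\<close>
    have "(norm w)\<^sup>2 = (s - r) * (s + r)" using s2 by (simp add: algebra_simps power2_eq_square)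
    also have "\<dots> \<le> (s - r) * (2 * s)" using rs by (intro mult_left_mono) auto
    finally have "(norm w)\<^sup>2 / (sqrt 2 * s) \<le> (s - r) * (2 * s) / (sqrt 2 * s)"
      using spos by (intro divide_right_mono) auto
    also have "\<dots> = sqrt 2 * (s - r)"
      using spos by (simp add: field_simps)
    finally have 2: "(norm w)\<^sup>2 / (sqrt 2 * s) \<le> sqrt 2 * (s - r)" .
    \<comment> \<open>Raising the weight of \<open>d\<close> from \<open>r\<close> to
      \<open>s\<close> costs little because the ball has diameter 2. With step size
      \<open>c / s\<close> the two errors are at most \<open>c * (s - r)\<close> and
      \<open>(2 / c) * (s - r)\<close>; \<open>c = sqrt 2\<close> balances them and minimizes their
      sum, whence the constant \<open>2 * sqrt 2\<close>.\<close>
    have "d * (s - r) / (2 * sqrt 2) \<le> 4 * (s - r) / (2 * sqrt 2)"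
      using d rs by (intro divide_right_mono mult_right_mono) auto
    also have "\<dots> = sqrt 2 * (s - r)" by (simp add: field_simps)
    finally have 3: "d * s / (2 * sqrt 2) \<le> d * r / (2 * sqrt 2) + sqrt 2 * (s - r)"
      by (simp add: right_diff_distrib diff_divide_distrib)
    from 1 2 3 show ?thesis by linarith
  qed
  have "(\<Sum>t=1..T. v t \<bullet> (u - ascent_point v (t - 1))) + d * r / (2 * sqrt 2) \<le> 2 * sqrt 2 * r"
    using Suc.IH unfolding d_def r_def x_def .
  moreover have "(\<Sum>t=1..Suc T. v t \<bullet> (u - ascent_point v (t - 1)))
      = (\<Sum>t=1..T. v t \<bullet> (u - ascent_point v (t - 1))) + w \<bullet> (u - x)"
    unfolding w_def x_def by simp
  ultimately show ?case
    using step unfolding e_def[symmetric] s_def[symmetric] by (simp add: right_diff_distrib)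
qed simp

lemma norm_sum_le_ascent:
  fixes v :: "nat \<Rightarrow> 'b::euclidean_space"
  shows "norm (\<Sum>t=1..T. v t)
    \<le> (\<Sum>t=1..T. v t \<bullet> ascent_point v (t - 1)) + 2 * sqrt 2 * sqrt (\<Sum>t=1..T. (norm (v t))\<^sup>2)"
proof -
  define S where "S = (\<Sum>t=1..T. v t)"
  \<comment> \<open>The comparator \<open>sgn S\<close> is 0 when \<open>S = 0\<close>, so it lies
    in the ball in every case.\<close>
  have "S \<bullet> sgn S = norm S"
    by (cases "S = 0") (simp_all add: sgn_div_norm dot_square_norm power2_eq_square)
  moreover have "(\<Sum>t=1..T. v t \<bullet> (sgn S - ascent_point v (t - 1)))
      \<le> 2 * sqrt 2 * sqrt (\<Sum>t=1..T. (norm (v t))\<^sup>2)"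
  proof -
    have "0 \<le> (norm (ascent_point v T - sgn S))\<^sup>2 * sqrt (\<Sum>t=1..T. (norm (v t))\<^sup>2) / (2 * sqrt 2)"
      by (auto intro!: divide_nonneg_nonneg mult_nonneg_nonneg sum_nonneg)
    moreover have "norm (sgn S) \<le> 1" by (simp add: norm_sgn)
    ultimately show ?thesis using ascent_regret_potential[of "sgn S" v T] by linarith
  qed
  moreover have "(\<Sum>t=1..T. v t \<bullet> (sgn S - ascent_point v (t - 1)))
      = S \<bullet> sgn S - (\<Sum>t=1..T. v t \<bullet> ascent_point v (t - 1))"
    by (simp add: S_def inner_sum_left inner_diff_right sum_subtractf)
  ultimately show ?thesis unfolding S_def by linarith
qed

section \<open>Comparison of finite power norms\<close>

text \<open>Every entry is at most the norm \<open>N\<close> with exponent \<open>q\<close>, so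
  \<open>r - q\<close> of its \<open>r\<close> powers can be replaced by powers of
  \<open>N\<close>.\<close>

lemma lp_norm_antimono:
  fixes a :: "'i \<Rightarrow> real"
  assumes "0 < q" "q \<le> r" and a: "\<And>i. i \<in> I \<Longrightarrow> 0 \<le> a i" and "finite I"
  shows "(\<Sum>i\<in>I. a i powr r) powr (1 / r) \<le> (\<Sum>i\<in>I. a i powr q) powr (1 / q)"
proof -
  define N where "N = (\<Sum>i\<in>I. a i powr q) powr (1 / q)"
  have N: "N \<ge> 0" by (simp add: N_def)
  have Nq: "N powr q = (\<Sum>i\<in>I. a i powr q)"
    using \<open>0 < q\<close> by (simp add: N_def powr_powr sum_nonneg)
  have le: "a i \<le> N" if "i \<in> I" for i
  proof -
    have "a i powr q \<le> (\<Sum>i\<in>I. a i powr q)"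
      using that \<open>finite I\<close> by (intro member_le_sum) auto
    then have "(a i powr q) powr (1 / q) \<le> N"
      unfolding N_def using \<open>0 < q\<close> by (intro powr_mono2) auto
    then show ?thesis using a[OF that] \<open>0 < q\<close> by (simp add: powr_powr)
  qed
  \<comment> \<open>Zero entries are covered: \<open>0 powr x\<close> is 0 for every
    \<open>x\<close>, even for \<open>x = 0\<close>.\<close>
  have "(\<Sum>i\<in>I. a i powr r) = (\<Sum>i\<in>I. a i powr (r - q) * a i powr q)"
    by (simp add: powr_add[symmetric])
  also have "\<dots> \<le> (\<Sum>i\<in>I. N powr (r - q) * a i powr q)"
    using a le \<open>q \<le> r\<close> by (intro sum_mono mult_right_mono powr_mono2) auto
  also have "\<dots> = N powr r"
    by (simp add: sum_distrib_left[symmetric] Nq[symmetric] powr_add[symmetric])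
  finally have "(\<Sum>i\<in>I. a i powr r) powr (1 / r) \<le> (N powr r) powr (1 / r)"
    using assms(1,2) by (intro powr_mono2) (auto intro: sum_nonneg)
  also have "\<dots> = N" using N assms(1,2) by (simp add: powr_powr)
  finally show ?thesis unfolding N_def .
qed

section \<open>Predictability and orthogonality to martingale differences\<close>

text \<open>\<open>N\<close> is left arbitrary so that it can be the natural filtration at time
  \<open>t\<close>. Projection onto the ball is continuous, hence preserves measurability.\<close>

lemma borel_measurable_ascent_point:
  fixes v :: "nat \<Rightarrow> 'a \<Rightarrow> 'b::euclidean_space"
  assumes "\<And>s. 1 \<le> s \<Longrightarrow> s \<le> t \<Longrightarrow> v s \<in> borel_measurable N"
  shows "(\<lambda>\<omega>. ascent_point (\<lambda>s. v s \<omega>) t) \<in> borel_measurable N"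
  using assms
proof (induction t)
  case (Suc t)
  have [measurable]: "(\<lambda>\<omega>. ascent_point (\<lambda>s. v s \<omega>) t) \<in> borel_measurable N"
    using Suc by simp
  have v: "v s \<in> borel_measurable N" if "s \<in> {1..Suc t}" for s
    using Suc.prems that by simp
  have [measurable]: "v (Suc t) \<in> borel_measurable N" using v by simp
  have [measurable]: "(\<lambda>\<omega>. \<Sum>s=1..Suc t. (norm (v s \<omega>))\<^sup>2) \<in> borel_measurable N"
    using v by (intro borel_measurable_sum borel_measurable_power
        measurable_compose[OF _ borel_measurable_norm])
  have [measurable]: "closest_point (cball 0 (1::real)) \<in> borel_measurable (borel :: 'b measure)"
    by (intro borel_measurable_continuous_onI continuous_on_closest_point) auto
  show ?case unfolding ascent_point.simps by measurable
qed simp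

text \<open>In each coordinate the factor from \<open>g\<close>, being measurable in
  \<open>F\<close>, allows \<open>f\<close> to be replaced by its conditional expectation under the
  integral. Boundedness of \<open>g\<close> makes the products integrable.\<close>

lemma (in sigma_finite_subalgebra) inner_vec_cond_exp_zero:
  fixes f g :: "'a \<Rightarrow> real ^ 'd"
  assumes f: "integrable M f" and zero: "AE \<omega> in M. vec_cond_exp M F f \<omega> = 0"
    and g: "g \<in> borel_measurable F" and bound: "\<And>\<omega>. norm (g \<omega>) \<le> B"
  shows "integrable M (\<lambda>\<omega>. f \<omega> \<bullet> g \<omega>)" and "(\<integral>\<omega>. f \<omega> \<bullet> g \<omega> \<partial>M) = 0"
proof -
  have fi: "integrable M (\<lambda>\<omega>. f \<omega> $ i)" for i
    using f by (simp add: vec_integrable_iff)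
  have giF: "(\<lambda>\<omega>. g \<omega> $ i) \<in> borel_measurable F" for i
    using borel_measurable_continuous_onI[OF continuous_on_component[OF continuous_on_id]] g
    by (rule measurable_compose_rev)
  then have giM: "(\<lambda>\<omega>. g \<omega> $ i) \<in> borel_measurable M" for i
    using measurable_from_subalg[OF subalg] by blast
  have int: "integrable M (\<lambda>\<omega>. g \<omega> $ i * f \<omega> $ i)" for i
  proof (rule Bochner_Integration.integrable_bound)
    show "integrable M (\<lambda>\<omega>. B * f \<omega> $ i)" using fi by simp
    show "(\<lambda>\<omega>. g \<omega> $ i * f \<omega> $ i) \<in> borel_measurable M"
      using giM fi by (intro borel_measurable_times) auto
    have "\<bar>g \<omega> $ i\<bar> \<le> \<bar>B\<bar>" for \<omega>
      using component_le_norm_cart[of "g \<omega>" i] bound[of \<omega>] by linarith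
    then show "AE \<omega> in M. norm (g \<omega> $ i * f \<omega> $ i) \<le> norm (B * f \<omega> $ i)"
      by (auto simp: abs_mult intro!: mult_right_mono)
  qed
  have null: "(\<integral>\<omega>. g \<omega> $ i * f \<omega> $ i \<partial>M) = 0" for i
  proof -
    have "(\<integral>\<omega>. g \<omega> $ i * f \<omega> $ i \<partial>M)
        = (\<integral>\<omega>. g \<omega> $ i * real_cond_exp M F (\<lambda>\<omega>. f \<omega> $ i) \<omega> \<partial>M)"
      using fi by (intro real_cond_exp_intg(2)[symmetric] int giF) auto
    also have "\<dots> = 0"
    proof (rule integral_eq_zero_AE)
      show "AE \<omega> in M. g \<omega> $ i * real_cond_exp M F (\<lambda>\<omega>. f \<omega> $ i) \<omega> = 0"
        using zero by eventually_elim (simp add: vec_cond_exp_def vec_eq_iff)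
    qed
    finally show ?thesis .
  qed
  have eq: "f \<omega> \<bullet> g \<omega> = (\<Sum>i\<in>UNIV. g \<omega> $ i * f \<omega> $ i)" for \<omega>
    by (simp add: inner_vec_def mult.commute)
  show "integrable M (\<lambda>\<omega>. f \<omega> \<bullet> g \<omega>)"
    unfolding eq using int by simp
  show "(\<integral>\<omega>. f \<omega> \<bullet> g \<omega> \<partial>M) = 0"
    unfolding eq using int null by simp
qed

section \<open>Integration of the pathwise bound\<close>

theorem lemma4p3:
  fixes M :: "'a measure" and v :: "nat \<Rightarrow> 'a \<Rightarrow> real ^ 'd" and p :: real
  assumes "prob_space M"
    and "\<And>t. t \<ge> 1 \<Longrightarrow> integrable M (v t)"
    and "\<And>t. t \<ge> 1 \<Longrightarrow>
           (AE \<omega> in M. vec_cond_exp M (natural_filtration M v (t - 1)) (v t) \<omega> = 0)"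
    and "p \<in> {1..2}"
  shows "\<forall>T\<ge>1. (\<integral>\<omega>. norm (\<Sum>t=1..T. v t \<omega>) \<partial>M)
           \<le> 2 * sqrt 2 * (\<integral>\<omega>. (\<Sum>t=1..T. norm (v t \<omega>) powr p) powr (1 / p) \<partial>M)"
proof (intro allI impI)
  fix T :: nat
  interpret prob_space M by fact
  let ?x = "\<lambda>t \<omega>. ascent_point (\<lambda>s. v s \<omega>) t"
  let ?N = "\<lambda>\<omega>. (\<Sum>t=1..T. norm (v t \<omega>) powr p) powr (1 / p)"
  have int: "integrable M (v t)" if "t \<in> {1..T}" for t
    using assms(2) that by simp
  have meas: "v t \<in> borel_measurable M" if "t \<in> {1..T}" for t
    using int[OF that] by (rule borel_measurable_integrable)
  have term_int: "integrable M (\<lambda>\<omega>. v t \<omega> \<bullet> ?x (t - 1) \<omega>)"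
    and term_zero: "(\<integral>\<omega>. v t \<omega> \<bullet> ?x (t - 1) \<omega> \<partial>M) = 0" if "t \<in> {1..T}" for t
  proof -
    let ?F = "natural_filtration M v (t - 1)"
    have "subalgebra M ?F"
      using assms(2) by (intro subalgebra_natural_filtration) auto
    then interpret finite_measure_subalgebra M ?F
      by unfold_locales
    \<comment> \<open>Round \<open>t\<close> plays \<open>?x (t - 1)\<close>, a function of the
      first \<open>t - 1\<close> vectors; for \<open>t = 1\<close> it is the constant 0.\<close>
    have "?x (t - 1) \<in> borel_measurable ?F"
      by (intro borel_measurable_ascent_point measurable_natural_filtration)
    then show "integrable M (\<lambda>\<omega>. v t \<omega> \<bullet> ?x (t - 1) \<omega>)"
      and "(\<integral>\<omega>. v t \<omega> \<bullet> ?x (t - 1) \<omega> \<partial>M) = 0"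
      using inner_vec_cond_exp_zero[of "v t" "?x (t - 1)" 1] assms(2,3) that
      by (auto simp: norm_ascent_point_le)
  qed
  \<comment> \<open>The integral of a non-integrable function defaults to 0, so the bound needs
    this. As \<open>p\<close> \<ge> 1, \<open>?N\<close> is dominated by the sum of the
    norms.\<close>
  have N_int: "integrable M ?N"
  proof (rule Bochner_Integration.integrable_bound)
    show "integrable M (\<lambda>\<omega>. \<Sum>t=1..T. norm (v t \<omega>))"
      using int by (intro Bochner_Integration.integrable_sum integrable_norm)
    have "(\<lambda>\<omega>. norm (v t \<omega>) powr p) \<in> borel_measurable M" if "t \<in> {1..T}" for t
      using meas[OF that] by measurable
    then have [measurable]: "(\<lambda>\<omega>. \<Sum>t=1..T. norm (v t \<omega>) powr p) \<in> borel_measurable M"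
      by (rule borel_measurable_sum)
    show "?N \<in> borel_measurable M" by measurable
    show "AE \<omega> in M. norm (?N \<omega>) \<le> norm (\<Sum>t=1..T. norm (v t \<omega>))"
    proof (rule AE_I2)
      fix \<omega>
      show "norm (?N \<omega>) \<le> norm (\<Sum>t=1..T. norm (v t \<omega>))"
        using lp_norm_antimono[of 1 p "{1..T}" "\<lambda>t. norm (v t \<omega>)"] \<open>p \<in> {1..2}\<close>
        by (simp add: sum_nonneg)
    qed
  qed
  have sum_int: "integrable M (\<lambda>\<omega>. \<Sum>t=1..T. v t \<omega> \<bullet> ?x (t - 1) \<omega>)"
    using term_int by (intro Bochner_Integration.integrable_sum)
  have "(\<integral>\<omega>. norm (\<Sum>t=1..T. v t \<omega>) \<partial>M)
      \<le> (\<integral>\<omega>. (\<Sum>t=1..T. v t \<omega> \<bullet> ?x (t - 1) \<omega>) + 2 * sqrt 2 * ?N \<omega> \<partial>M)"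
  proof (rule integral_mono)
    show "integrable M (\<lambda>\<omega>. norm (\<Sum>t=1..T. v t \<omega>))"
      using int by (intro integrable_norm Bochner_Integration.integrable_sum)
    show "integrable M (\<lambda>\<omega>. (\<Sum>t=1..T. v t \<omega> \<bullet> ?x (t - 1) \<omega>) + 2 * sqrt 2 * ?N \<omega>)"
      using sum_int N_int by (intro Bochner_Integration.integrable_add integrable_mult_right)
    fix \<omega>
    \<comment> \<open>Here the other end of the range of \<open>p\<close> enters: \<open>p\<close>
      \<le> 2.\<close>
    have "sqrt (\<Sum>t=1..T. (norm (v t \<omega>))\<^sup>2) \<le> ?N \<omega>"
      using lp_norm_antimono[of p 2 "{1..T}" "\<lambda>t. norm (v t \<omega>)"] \<open>p \<in> {1..2}\<close>
      by (simp add: powr_half_sqrt sum_nonneg)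
    then have "2 * sqrt 2 * sqrt (\<Sum>t=1..T. (norm (v t \<omega>))\<^sup>2) \<le> 2 * sqrt 2 * ?N \<omega>"
      by (intro mult_left_mono) auto
    then show "norm (\<Sum>t=1..T. v t \<omega>)
        \<le> (\<Sum>t=1..T. v t \<omega> \<bullet> ?x (t - 1) \<omega>) + 2 * sqrt 2 * ?N \<omega>"
      using norm_sum_le_ascent[of "\<lambda>t. v t \<omega>" T] by linarith
  qed
  also have "\<dots> = (\<Sum>t=1..T. \<integral>\<omega>. v t \<omega> \<bullet> ?x (t - 1) \<omega> \<partial>M) + 2 * sqrt 2 * (\<integral>\<omega>. ?N \<omega> \<partial>M)"
    using sum_int N_int term_int by simp
  also have "\<dots> = 2 * sqrt 2 * (\<integral>\<omega>. ?N \<omega> \<partial>M)"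
    using term_zero by simp
  finally show "(\<integral>\<omega>. norm (\<Sum>t=1..T. v t \<omega>) \<partial>M) \<le> 2 * sqrt 2 * (\<integral>\<omega>. ?N \<omega> \<partial>M)" .
qed

end
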